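(* Let $\mathcal V$ be a non-principal ultrafilter on $\mathbb N$ and let $\xi,\eta\in\mu^+(0)$. Then ${}^{\ast}T_L(\xi,\eta)={}^{\ast}T_{NM}(\xi,\eta)={}^{\ast}T_D(\xi,\eta)=0$.
   Context: ${}^{\ast}\mathbb R=\mathbb R^{\mathbb N}/\mathcal V$ is the ultrapower of the ordered field of real numbers, and ${}^{\ast}[0,1]\subseteq{}^{\ast}\mathbb R$ is the induced ultrapower of $[0,1]$. For $T:[0,1]^2\to[0,1]$, the extension ${}^{\ast}T:{}^{\ast}[0,1]^2\to{}^{\ast}[0,1]$ is ${}^{\ast}T([x_n]_{\mathcal V},[y_n]_{\mathcal V})=[T(x_n,y_n)]_{\mathcal V}$. The right monad of $0$ is $\mu^+(0)=\{\xi\in{}^{\ast}[0,1]:0<\xi<\tfrac1n\text{ for every integer }n\ge2\}$. The operations $[0,1]^2\to[0,1]$ are: $T_L(x,y)=\max\{0,x+y-1\}$; $T_{NM}(x,y)=\min\{x,y\}$ if $x+y>1$ and $0$ if $x+y\le 1$; $T_D(x,y)=\min\{x,y\}$ if $\max\{x,y\}=1$ and $0$ if $\max\{x,y\}<1$. *)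

theory Defs
  imports Complex_Main
begin

text \<open>An ultrafilter is given as a \<open>filter\<close>: the set \<open>A\<close> belongs to \<open>V\<close> iff
  \<open>eventually (\<lambda>n. n \<in> A) V\<close>.\<close>

definition ultrafilter :: "'i filter \<Rightarrow> bool" where
  "ultrafilter V \<longleftrightarrow>
     V \<noteq> bot \<and> (\<forall>P. eventually P V \<or> eventually (\<lambda>i. \<not> P i) V)"

definition nonprincipal :: "'i filter \<Rightarrow> bool" where
  "nonprincipal V \<longleftrightarrow> (\<forall>i. V \<noteq> principal {i})"

text \<open>The ultrapower depends on the variable \<open>V\<close>, so it is a set of equivalence classes of
  sequences rather than a type.\<close>

definition ueq :: "nat filter \<Rightarrow> ((nat \<Rightarrow> real) \<times> (nat \<Rightarrow> real)) set" where
  "ueq V = {(x, y). eventually (\<lambda>n. x n = y n) V}"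

definition ucls :: "nat filter \<Rightarrow> (nat \<Rightarrow> real) \<Rightarrow> (nat \<Rightarrow> real) set" where
  "ucls V x = ueq V `` {x}"

definition star_real :: "nat filter \<Rightarrow> (nat \<Rightarrow> real) set set" where
  "star_real V = UNIV // ueq V"

definition star_unit :: "nat filter \<Rightarrow> (nat \<Rightarrow> real) set set" where
  "star_unit V = {ucls V x | x. \<forall>n. x n \<in> {0..1}}"

definition star_of :: "nat filter \<Rightarrow> real \<Rightarrow> (nat \<Rightarrow> real) set" where
  "star_of V r = ucls V (\<lambda>n. r)"

definition star_less :: "nat filter \<Rightarrow> (nat \<Rightarrow> real) set \<Rightarrow> (nat \<Rightarrow> real) set \<Rightarrow> bool" where
  "star_less V \<xi> \<eta> \<longleftrightarrow> (\<exists>x\<in>\<xi>. \<exists>y\<in>\<eta>. eventually (\<lambda>n. x n < y n) V)"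

text \<open>The operation \<open>T\<close> matters only on the unit square, hence only representatives with all
  values in the unit interval are used; see \<open>star_ext2_ucls\<close> for well-definedness.\<close>

definition star_ext2 ::
    "nat filter \<Rightarrow> (real \<Rightarrow> real \<Rightarrow> real) \<Rightarrow>
      (nat \<Rightarrow> real) set \<Rightarrow> (nat \<Rightarrow> real) set \<Rightarrow> (nat \<Rightarrow> real) set" where
  "star_ext2 V T \<xi> \<eta> =
     (THE \<zeta>. \<exists>x y. (\<forall>n. x n \<in> {0..1}) \<and> (\<forall>n. y n \<in> {0..1}) \<and>
        \<xi> = ucls V x \<and> \<eta> = ucls V y \<and> \<zeta> = ucls V (\<lambda>n. T (x n) (y n)))"

definition right_monad_zero :: "nat filter \<Rightarrow> (nat \<Rightarrow> real) set set" where
  "right_monad_zero V =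
     {\<xi> \<in> star_unit V. star_less V (star_of V 0) \<xi> \<and>
        (\<forall>n::nat. n \<ge> 2 \<longrightarrow> star_less V \<xi> (star_of V (1 / real n)))}"

definition T_L :: "real \<Rightarrow> real \<Rightarrow> real" where
  "T_L x y = max 0 (x + y - 1)"

definition T_NM :: "real \<Rightarrow> real \<Rightarrow> real" where
  "T_NM x y = (if x + y > 1 then min x y else 0)"

definition T_D :: "real \<Rightarrow> real \<Rightarrow> real" where
  "T_D x y = (if max x y = 1 then min x y else 0)"

lemma equiv_ueq: "equiv UNIV (ueq V)"
proof (rule equivI)
  show "refl (ueq V)"
    by (simp add: ueq_def refl_on_def)
  show "sym (ueq V)"
    by (simp add: ueq_def sym_def eq_commute)
  show "trans (ueq V)"
    unfolding trans_def ueq_def by (auto elim: eventually_elim2)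
qed (simp add: ueq_def)

lemma ucls_eq_iff: "ucls V x = ucls V y \<longleftrightarrow> eventually (\<lambda>n. x n = y n) V"
  unfolding ucls_def by (simp add: eq_equiv_class_iff[OF equiv_ueq]) (simp add: ueq_def)

lemma star_unit_subset: "star_unit V \<subseteq> star_real V"
  by (auto simp: star_unit_def star_real_def ucls_def intro: quotientI)

lemma star_less_ucls:
  "star_less V (ucls V x) (ucls V y) \<longleftrightarrow> eventually (\<lambda>n. x n < y n) V"
proof
  assume "star_less V (ucls V x) (ucls V y)"
  then obtain x' y' where "eventually (\<lambda>n. x n = x' n) V" "eventually (\<lambda>n. y n = y' n) V"
    "eventually (\<lambda>n. x' n < y' n) V"
    by (auto simp: star_less_def ucls_def ueq_def)
  then show "eventually (\<lambda>n. x n < y n) V"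
    by eventually_elim simp
next
  assume "eventually (\<lambda>n. x n < y n) V"
  then show "star_less V (ucls V x) (ucls V y)"
    unfolding star_less_def
    by (intro bexI[of _ x] bexI[of _ y]) (simp_all add: ucls_def ueq_def)
qed

lemma star_ext2_ucls:
  assumes "\<forall>n. x n \<in> {0..1}" "\<forall>n. y n \<in> {0..1}"
  shows "star_ext2 V T (ucls V x) (ucls V y) = ucls V (\<lambda>n. T (x n) (y n))"
  unfolding star_ext2_def
proof (rule the_equality)
  show "\<exists>x' y'. (\<forall>n. x' n \<in> {0..1}) \<and> (\<forall>n. y' n \<in> {0..1}) \<and>
      ucls V x = ucls V x' \<and> ucls V y = ucls V y' \<and>
      ucls V (\<lambda>n. T (x n) (y n)) = ucls V (\<lambda>n. T (x' n) (y' n))"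
    using assms by blast
next
  fix \<zeta>
  assume "\<exists>x' y'. (\<forall>n. x' n \<in> {0..1}) \<and> (\<forall>n. y' n \<in> {0..1}) \<and>
      ucls V x = ucls V x' \<and> ucls V y = ucls V y' \<and> \<zeta> = ucls V (\<lambda>n. T (x' n) (y' n))"
  then obtain x' y' where eq: "eventually (\<lambda>n. x n = x' n) V" "eventually (\<lambda>n. y n = y' n) V"
    and \<zeta>: "\<zeta> = ucls V (\<lambda>n. T (x' n) (y' n))"
    by (auto simp: ucls_eq_iff)
  have "eventually (\<lambda>n. T (x' n) (y' n) = T (x n) (y n)) V"
    using eq by eventually_elim simp
  then show "\<zeta> = ucls V (\<lambda>n. T (x n) (y n))"
    by (simp add: \<zeta> ucls_eq_iff)
qed

end

theory Submission
  imports Defs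
begin

text \<open>The three operations vanish identically on the square \<open>[0, 1/2)\<^sup>2\<close>: there \<open>x + y < 1\<close>,
  which settles \<open>T_L\<close> and \<open>T_NM\<close>, and \<open>max x y < 1\<close>, which settles \<open>T_D\<close>. An element of the right
  monad of \<open>0\<close> lies below \<open>1/2\<close>, so its representatives are below \<open>1/2\<close> at \<open>V\<close>-almost every index.
  Two such sets of indices intersect in a set of the filter, and on it the composed sequence
  is \<open>0\<close>.\<close>

lemma right_monad_zero_representative:
  assumes "\<xi> \<in> right_monad_zero V"
  obtains x where "\<xi> = ucls V x" "\<forall>n. x n \<in> {0..1}" "eventually (\<lambda>n. x n < 1/2) V"
proof -
  from assms obtain x where x: "\<xi> = ucls V x" "\<forall>n. x n \<in> {0..1}"
    by (auto simp: right_monad_zero_def star_unit_def)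
  have "star_less V \<xi> (star_of V (1 / real 2))"
    using assms unfolding right_monad_zero_def by blast
  then have "eventually (\<lambda>n. x n < 1/2) V"
    by (simp add: x(1) star_of_def star_less_ucls)
  with x that show thesis by blast
qed

text \<open>Equality in the ultrapower is equality of representatives at \<open>V\<close>-almost every index, so it is
  enough that \<open>T\<close> vanishes at the values taken on the common index set.\<close>

lemma star_ext2_eq_zero_on_right_monad:
  assumes "\<xi> \<in> right_monad_zero V" and "\<eta> \<in> right_monad_zero V"
    and T: "\<And>a b. 0 \<le> a \<Longrightarrow> a < 1/2 \<Longrightarrow> 0 \<le> b \<Longrightarrow> b < 1/2 \<Longrightarrow> T a b = 0"
  shows "star_ext2 V T \<xi> \<eta> = star_of V 0"
proof -
  obtain x where x: "\<xi> = ucls V x" "\<forall>n. x n \<in> {0..1}" "eventually (\<lambda>n. x n < 1/2) V"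
    using assms(1) by (rule right_monad_zero_representative)
  obtain y where y: "\<eta> = ucls V y" "\<forall>n. y n \<in> {0..1}" "eventually (\<lambda>n. y n < 1/2) V"
    using assms(2) by (rule right_monad_zero_representative)
  have "eventually (\<lambda>n. T (x n) (y n) = 0) V"
    using x(3) y(3) by eventually_elim (use x(2) y(2) in \<open>auto intro: T\<close>)
  then show ?thesis
    by (simp add: x(1) y(1) star_ext2_ucls[OF x(2) y(2)] star_of_def ucls_eq_iff)
qed

theorem proposition7p4:
  fixes V :: "nat filter" and \<xi> \<eta> :: "(nat \<Rightarrow> real) set"
  assumes "ultrafilter V" and "nonprincipal V"
    and "\<xi> \<in> right_monad_zero V" and "\<eta> \<in> right_monad_zero V"
  shows "star_ext2 V T_L \<xi> \<eta> = star_ext2 V T_NM \<xi> \<eta> \<and>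
    star_ext2 V T_NM \<xi> \<eta> = star_ext2 V T_D \<xi> \<eta> \<and>
    star_ext2 V T_D \<xi> \<eta> = star_of V 0"
proof -
  have "star_ext2 V T_L \<xi> \<eta> = star_of V 0"
    using assms(3,4) by (rule star_ext2_eq_zero_on_right_monad) (simp add: T_L_def)
  moreover have "star_ext2 V T_NM \<xi> \<eta> = star_of V 0"
    using assms(3,4) by (rule star_ext2_eq_zero_on_right_monad) (simp add: T_NM_def)
  moreover have "star_ext2 V T_D \<xi> \<eta> = star_of V 0"
    using assms(3,4) by (rule star_ext2_eq_zero_on_right_monad) (simp add: T_D_def max_def)
  ultimately show ?thesis by simp
qed

end
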